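(* Let $f:\mathbb{C}\to\mathbb{C}$ be a transcendental entire function and suppose that there exists a bounded domain $U\subset\mathbb{C}$ with $\partial U\subset I(f)$ and $U\cap J(f)\neq\emptyset$. Then: (a) the sets $\alpha_n=\partial\,\widetilde{f^n(U)}$ are contained in $I(f)$, $\alpha_n\to\infty$ as $n\to\infty$, and $\alpha_n$ surrounds $0$ for all sufficiently large $n$; (b) $I(f)$ is connected.
   Context: $\mathbb{N}=\{1,2,3,\dots\}$ and $f^n$ denotes the $n$th iterate of $f$. The Fatou set $F(f)$ is the set of $z\in\mathbb{C}$ such that $(f^n)_{n\in\mathbb{N}}$ is a normal family in some neighbourhood of $z$; the Julia set is $J(f)=\mathbb{C}\setminus F(f)$. The escaping set is $I(f)=\{z\in\mathbb{C}: f^n(z)\to\infty \text{ as } n\to\infty\}$. A domain is a non-empty connected open set. For a bounded domain $G$, $\widetilde{G}$ denotes the union of $G$ and the bounded components of $\mathbb{C}\setminus G$. For compact sets $\alpha_n$, $\alpha_n\to\infty$ means $\min_{z\in\alpha_n}|z|\to\infty$. A compact set $\alpha$ surrounds a point (or a connected set) if that point (or set) lies in a bounded component of $\mathbb{C}\setminus\alpha$. *)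

theory Defs
  imports "HOL-Complex_Analysis.Complex_Analysis"
begin

definition transcendental_entire :: "(complex \<Rightarrow> complex) \<Rightarrow> bool" where
  "transcendental_entire f \<longleftrightarrow> f holomorphic_on UNIV \<and> (\<nexists>p. f = poly p)"

text \<open>Normality in the sense of Montel: subsequences may converge locally uniformly to a finite
  limit function or to infinity.  For holomorphic functions on a connected open set this is
  locally uniform subsequential convergence with respect to the spherical metric (by Hurwitz,
  a spherical limit is either finite everywhere or identically infinite).\<close>

definition normal_family_on :: "complex set \<Rightarrow> (complex \<Rightarrow> complex) set \<Rightarrow> bool" where
  "normal_family_on V \<F> \<longleftrightarrow>
     (\<forall>s :: nat \<Rightarrow> complex \<Rightarrow> complex. range s \<subseteq> \<F> \<longrightarrow>
       (\<exists>r :: nat \<Rightarrow> nat. strict_mono r \<and>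
         ((\<exists>g. \<forall>K. compact K \<and> K \<subseteq> V \<longrightarrow> uniform_limit K (\<lambda>k. s (r k)) g sequentially) \<or>
          (\<forall>K. compact K \<and> K \<subseteq> V \<longrightarrow>
             (\<forall>B::real. \<forall>\<^sub>F k in sequentially. \<forall>z\<in>K. B \<le> norm (s (r k) z))))))"

definition Fatou_set :: "(complex \<Rightarrow> complex) \<Rightarrow> complex set" where
  "Fatou_set f =
     {z. \<exists>V. open V \<and> connected V \<and> z \<in> V \<and> normal_family_on V {f ^^ n | n. n \<ge> 1}}"

definition Julia_set :: "(complex \<Rightarrow> complex) \<Rightarrow> complex set" where
  "Julia_set f = - Fatou_set f"

definition escaping_set :: "(complex \<Rightarrow> complex) \<Rightarrow> complex set" where
  "escaping_set f = {z. filterlim (\<lambda>n. (f ^^ n) z) at_infinity sequentially}"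

definition fill_holes :: "complex set \<Rightarrow> complex set" where
  "fill_holes G = G \<union> \<Union>{C \<in> components (- G). bounded C}"

text \<open>For a non-empty compact set the infimum below is the minimum of the moduli; compactness and
  non-emptiness are required because the infimum of the empty set of reals is unspecified.
  Sequences of sets are indexed by the positive integers.\<close>

definition compact_sets_to_infinity :: "(nat \<Rightarrow> complex set) \<Rightarrow> bool" where
  "compact_sets_to_infinity \<alpha> \<longleftrightarrow>
     (\<forall>n\<ge>1. compact (\<alpha> n) \<and> \<alpha> n \<noteq> {}) \<and>
     filterlim (\<lambda>n. INF z\<in>\<alpha> n. norm z) at_top sequentially"

definition surrounds :: "complex set \<Rightarrow> complex \<Rightarrow> bool" where
  "surrounds \<alpha> z \<longleftrightarrow> compact \<alpha> \<and> (\<exists>C \<in> components (- \<alpha>). bounded C \<and> z \<in> C)"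

end

theory Submission
  imports Defs
begin

text \<open>
  A neighbourhood of a Julia point contains, by Montel's theorem, a preimage of one of any two
  given points, so \<open>U\<close> contains a point \<open>p\<close> of bounded orbit and an escaping point \<open>q\<close>.
  If for infinitely many \<open>n\<close> the filled set \<open>W\<^sub>n\<close> of \<open>f\<^sup>n(U)\<close> did not contain the disc of radius \<open>R\<close>,
  the unbounded complementary component would provide omitted values of modulus \<open>R + 1\<close> and
  \<open>R + 2\<close>; normalising these to \<open>0\<close> and \<open>1\<close> gives a normal family, which is impossible because
  it is bounded at \<open>p\<close> and unbounded along every subsequence at \<open>q\<close>.  Hence \<open>W\<^sub>n\<close> eventually swallows
  every disc.

  If \<open>I(f)\<close> were disconnected, some closed connected set \<open>A\<close> in its complement would separate two
  escaping points.  Since \<open>A\<close> cannot cross the frontiers of the \<open>W\<^sub>n\<close>, it is bounded, so a bounded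
  component \<open>H\<close> of its complement contains an escaping point \<open>z\<close>.  Once \<open>f\<^sup>n(z)\<close> has left \<open>W\<^sub>m\<close>, so has
  \<open>f\<^sup>n(A)\<close>: otherwise it would lie in \<open>W\<^sub>m\<close>, and \<open>f\<^sup>n(H)\<close> would contain the unbounded complement of
  \<open>W\<^sub>m\<close>.  Thus \<open>A\<close> escapes, a contradiction.
\<close>

section \<open>Montel's normality criterion\<close>

lemma normal_family_on_omits_01:
  assumes V: "open V" "connected V"
    and hol: "\<And>h. h \<in> F \<Longrightarrow> h holomorphic_on V"
    and omit: "\<And>h z. h \<in> F \<Longrightarrow> z \<in> V \<Longrightarrow> h z \<noteq> 0 \<and> h z \<noteq> 1"
  shows "normal_family_on V F"
proof (cases "V = {}")
  case True
  then show ?thesis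
    unfolding normal_family_on_def by (auto intro!: exI[of _ id] strict_mono_id)
next
  case False
  then obtain w where w: "w \<in> V" by blast
  let ?lim = "\<lambda>t. \<exists>g r. g holomorphic_on V \<and> strict_mono r \<and>
      (\<forall>K. compact K \<and> K \<subseteq> V \<longrightarrow> uniform_limit K (\<lambda>k. t (r k :: nat)) g sequentially)"
  \<comment> \<open>Schottky's theorem, here \<open>GPicard3\<close>, spreads the bound at the
    single point \<open>w\<close> to every compact subset of \<open>V\<close>; this is the local
    boundedness that Montel's theorem asks for.\<close>
  have montel: "?lim t"
    if t: "\<And>k. t k holomorphic_on V" "\<And>k z. z \<in> V \<Longrightarrow> t k z \<noteq> 0 \<and> t k z \<noteq> 1"
      "\<And>k. norm (t k w) \<le> 1" for t :: "nat \<Rightarrow> complex \<Rightarrow> complex"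
  proof -
    obtain g r where "g holomorphic_on V" "strict_mono (r :: nat \<Rightarrow> nat)"
      "\<And>K. compact K \<Longrightarrow> K \<subseteq> V \<Longrightarrow> uniform_limit K (t \<circ> r) g sequentially"
    proof (rule Montel[OF V(1), of "range t" t])
      fix K assume K: "compact K" "K \<subseteq> V"
      obtain B where "\<And>h z. h \<in> range t \<Longrightarrow> z \<in> K \<Longrightarrow> norm (h z) \<le> B"
        by (rule GPicard3[OF V w subset_refl, of "range t" K]) (use t K in auto)
      then show "\<exists>B. \<forall>h\<in>range t. \<forall>z\<in>K. norm (h z) \<le> B"
        by blast
    qed (use t in auto)
    then show ?thesis by (auto simp: o_def)
  qed
  show ?thesis
    unfolding normal_family_on_def
  proof (intro allI impI)
    fix s :: "nat \<Rightarrow> complex \<Rightarrow> complex"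
    assume s: "range s \<subseteq> F"
    then have hol_s: "s k holomorphic_on V" and omit_s: "z \<in> V \<Longrightarrow> s k z \<noteq> 0 \<and> s k z \<noteq> 1" for k z
      using hol omit by auto
    show "\<exists>r. strict_mono r \<and>
        ((\<exists>g. \<forall>K. compact K \<and> K \<subseteq> V \<longrightarrow> uniform_limit K (\<lambda>k. s (r k)) g sequentially) \<or>
        (\<forall>K. compact K \<and> K \<subseteq> V \<longrightarrow>
          (\<forall>B::real. \<forall>\<^sub>F k in sequentially. \<forall>z\<in>K. B \<le> norm (s (r k) z))))"
      \<comment> \<open>Schottky-type bounds need a subsequence bounded at \<open>w\<close>: either \<open>s\<close> or \<open>1/s\<close> has one.
        In the second case Hurwitz says that the limit of \<open>1/s\<close> vanishes nowhere or identically.\<close>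
    proof (cases "infinite {k. norm (s k w) \<le> 1}")
      case True
      define e where "e = enumerate {k. norm (s k w) \<le> 1}"
      have e: "strict_mono e" "norm (s (e k) w) \<le> 1" for k
        using strict_mono_enumerate[OF True] enumerate_in_set[OF True] by (auto simp: e_def)
      have "?lim (\<lambda>k. s (e k))"
        by (intro montel hol_s omit_s e(2))
      then obtain g r where "strict_mono (r :: nat \<Rightarrow> nat)"
        "\<forall>K. compact K \<and> K \<subseteq> V \<longrightarrow> uniform_limit K (\<lambda>k. s (e (r k))) g sequentially"
        by blast
      then show ?thesis
        using strict_mono_o[OF e(1), of r] by (intro exI[of _ "e \<circ> r"]) (auto simp: o_def)
    next
      case False
      then have inf: "infinite {k. \<not> norm (s k w) \<le> 1}"
        using finite_compl[of "{k. norm (s k w) \<le> 1}"] by (simp add: Collect_neg_eq)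
      define e where "e = enumerate {k. \<not> norm (s k w) \<le> 1}"
      have e: "strict_mono e" "norm (s (e k) w) > 1" for k
        using strict_mono_enumerate[OF inf] enumerate_in_set[OF inf]
        by (auto simp: e_def not_le)
      define t where "t = (\<lambda>k z. inverse (s (e k) z))"
      have hol_t: "t k holomorphic_on V" for k
        unfolding t_def using hol_s omit_s by (intro holomorphic_intros) auto
      have omit_t: "t k z \<noteq> 0 \<and> t k z \<noteq> 1" if "z \<in> V" for k z
        using omit_s[OF that] by (auto simp: t_def)
      have t_w: "norm (t k w) \<le> 1" for k
        using e(2)[of k] by (simp add: t_def norm_inverse inverse_le_1_iff less_imp_le)
      have "?lim t"
        by (intro montel hol_t omit_t t_w)
      then obtain g r where g: "g holomorphic_on V" and r: "strict_mono (r :: nat \<Rightarrow> nat)"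
        and lim: "\<And>K. compact K \<Longrightarrow> K \<subseteq> V \<Longrightarrow> uniform_limit K (\<lambda>k. t (r k)) g sequentially"
        by blast
      have mono: "strict_mono (\<lambda>k. e (r k))"
        using strict_mono_o[OF e(1) r] by (simp add: o_def)
      show ?thesis
      proof (cases "\<exists>z\<in>V. g z = 0")
        case True
        then obtain z0 where z0: "z0 \<in> V" "g z0 = 0" by blast
        have "g constant_on V"
          using Hurwitz_no_zeros[OF V, of "\<lambda>k. t (r k)" g z0] hol_t g lim omit_t z0 by blast
        with z0 have g0: "g z = 0" if "z \<in> V" for z
          using that by (metis constant_on_def)
        have "\<forall>\<^sub>F k in sequentially. \<forall>z\<in>K. B \<le> norm (s (e (r k)) z)"
          if K: "compact K" "K \<subseteq> V" for K B
        proof -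
          \<comment> \<open>The absolute value keeps the threshold positive for every real
            \<open>B\<close>; inverting it yields \<open>\<bar>B\<bar> + 1\<close>, which exceeds
            \<open>B\<close>.\<close>
          have "\<forall>\<^sub>F k in sequentially. \<forall>z\<in>K. dist (t (r k) z) (g z) < inverse (\<bar>B\<bar> + 1)"
            using lim[OF K] by (intro uniform_limitD) auto
          then show ?thesis
          proof (eventually_elim, intro ballI)
            fix k z assume *: "\<forall>z\<in>K. dist (t (r k) z) (g z) < inverse (\<bar>B\<bar> + 1)" and "z \<in> K"
            moreover have "z \<in> V"
              using K \<open>z \<in> K\<close> by blast
            ultimately have "inverse (norm (s (e (r k)) z)) < inverse (\<bar>B\<bar> + 1)"
              using g0[of z] by (force simp: t_def norm_inverse)
            then have "\<bar>B\<bar> + 1 < norm (s (e (r k)) z)"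
              using omit_s[of z "e (r k)"] \<open>z \<in> V\<close> by (subst (asm) inverse_less_iff_less) auto
            then show "B \<le> norm (s (e (r k)) z)" by linarith
          qed
        qed
        with mono show ?thesis by blast
      next
        case False
        have "uniform_limit K (\<lambda>k. s (e (r k))) (\<lambda>z. inverse (g z)) sequentially"
          if K: "compact K" "K \<subseteq> V" for K
        proof (cases "K = {}")
          case False
          have cont: "continuous_on K (\<lambda>z. norm (g z))"
            using g K by (intro continuous_intros holomorphic_on_imp_continuous_on)
              (auto intro: holomorphic_on_subset)
          \<comment> \<open>Reciprocals converge uniformly only where \<open>g\<close> stays away
            from 0; the minimum of its modulus over \<open>K\<close> is such a positive
            bound.\<close>
          obtain x where x: "x \<in> K" "\<And>z. z \<in> K \<Longrightarrow> norm (g x) \<le> norm (g z)"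
            using continuous_attains_inf[OF K(1) False cont] by blast
          have "uniform_limit K (\<lambda>k z. inverse (t (r k) z)) (inverse \<circ> g) sequentially"
            using uniform_lim_inverse[OF lim[OF K], of "norm (g x)"] x K \<open>\<not> (\<exists>z\<in>V. g z = 0)\<close>
            by (force simp: o_def)
          then show ?thesis by (simp add: t_def o_def)
        qed auto
        with mono show ?thesis by blast
      qed
    qed
  qed
qed

text \<open>The affine map taking \<open>a\<close> to 0 and \<open>b\<close> to 1 reduces this to
  the previous lemma, and both alternatives of normality survive the inverse map.\<close>

lemma normal_family_on_omits:
  assumes V: "open V" "connected V" and ab: "a \<noteq> b"
    and hol: "\<And>h. h \<in> F \<Longrightarrow> h holomorphic_on V"
    and omit: "\<And>h z. h \<in> F \<Longrightarrow> z \<in> V \<Longrightarrow> h z \<noteq> a \<and> h z \<noteq> b"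
  shows "normal_family_on V F"
  unfolding normal_family_on_def
proof (intro allI impI)
  fix s :: "nat \<Rightarrow> complex \<Rightarrow> complex"
  assume s: "range s \<subseteq> F"
  define t where "t = (\<lambda>k z. (s k z - a) / (b - a))"
  have s_eq: "s k z = (b - a) * t k z + a" for k z
    using ab by (simp add: t_def)
  have "normal_family_on V (range t)"
  proof (rule normal_family_on_omits_01[OF V])
    show "h holomorphic_on V" if "h \<in> range t" for h
      using that s hol ab unfolding t_def by (auto intro!: holomorphic_intros)
    show "h z \<noteq> 0 \<and> h z \<noteq> 1" if h: "h \<in> range t" and z: "z \<in> V" for h z
    proof -
      obtain k where k: "h = t k" using h by blast
      show ?thesis
        using omit[of "s k" z] s z ab by (auto simp: k t_def)
    qed
  qed
  then obtain r where r: "strict_mono (r :: nat \<Rightarrow> nat)" and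
    alt: "(\<exists>g. \<forall>K. compact K \<and> K \<subseteq> V \<longrightarrow> uniform_limit K (\<lambda>k. t (r k)) g sequentially) \<or>
      (\<forall>K. compact K \<and> K \<subseteq> V \<longrightarrow>
        (\<forall>B::real. \<forall>\<^sub>F k in sequentially. \<forall>z\<in>K. B \<le> norm (t (r k) z)))"
    unfolding normal_family_on_def by blast
  show "\<exists>r. strict_mono r \<and>
      ((\<exists>g. \<forall>K. compact K \<and> K \<subseteq> V \<longrightarrow> uniform_limit K (\<lambda>k. s (r k)) g sequentially) \<or>
      (\<forall>K. compact K \<and> K \<subseteq> V \<longrightarrow>
        (\<forall>B::real. \<forall>\<^sub>F k in sequentially. \<forall>z\<in>K. B \<le> norm (s (r k) z))))"
    using alt
  proof
    assume "\<exists>g. \<forall>K. compact K \<and> K \<subseteq> V \<longrightarrow> uniform_limit K (\<lambda>k. t (r k)) g sequentially"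
    then obtain g where
      "\<And>K. compact K \<Longrightarrow> K \<subseteq> V \<Longrightarrow> uniform_limit K (\<lambda>k. t (r k)) g sequentially"
      by blast
    then have "uniform_limit K (\<lambda>k z. (b - a) * t (r k) z + a) (\<lambda>z. (b - a) * g z + a) sequentially"
      if "compact K" "K \<subseteq> V" for K
      using that by (intro uniform_limit_intros bounded_linear.uniform_limit[OF bounded_linear_mult_right])
    then show ?thesis
      using r by (intro exI[of _ r] conjI disjI1 exI[of _ "\<lambda>z. (b - a) * g z + a"])
        (auto simp: s_eq[abs_def])
  next
    assume inf: "\<forall>K. compact K \<and> K \<subseteq> V \<longrightarrow>
        (\<forall>B::real. \<forall>\<^sub>F k in sequentially. \<forall>z\<in>K. B \<le> norm (t (r k) z))"
    have "\<forall>\<^sub>F k in sequentially. \<forall>z\<in>K. B \<le> norm (s (r k) z)" if K: "compact K" "K \<subseteq> V" for K B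
    proof -
      have "\<forall>\<^sub>F k in sequentially. \<forall>z\<in>K. (B + norm a) / norm (b - a) \<le> norm (t (r k) z)"
        using inf K by blast
      then show ?thesis
      proof (eventually_elim, intro ballI)
        fix k z assume "\<forall>z\<in>K. (B + norm a) / norm (b - a) \<le> norm (t (r k) z)" "z \<in> K"
        then have "B + norm a \<le> norm (s (r k) z - a)"
          using ab by (auto simp: t_def norm_divide divide_le_cancel)
        also have "\<dots> \<le> norm (s (r k) z) + norm a"
          by (rule norm_triangle_ineq4)
        finally show "B \<le> norm (s (r k) z)" by simp
      qed
    qed
    with r show ?thesis by blast
  qed
qed

section \<open>Orbits of a transcendental entire function\<close>

lemma funpow_holomorphic_on:
  assumes "f holomorphic_on UNIV"
  shows "(f ^^ n) holomorphic_on A"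
proof -
  have "(f ^^ n) holomorphic_on UNIV"
  proof (induction n)
    case 0
    then show ?case by (simp add: id_def)
  next
    case (Suc n)
    then show ?case
      using holomorphic_on_compose_gen[OF Suc assms subset_UNIV] by (simp only: funpow.simps)
  qed
  then show ?thesis by (rule holomorphic_on_subset) simp
qed

text \<open>Otherwise Montel's criterion makes the iterates normal on \<open>U\<close> and puts all
  of \<open>U\<close> into the Fatou set. The exponent may be 0, in which case \<open>z\<close>
  itself is \<open>a\<close> or \<open>b\<close>.\<close>

lemma Julia_hits_one_of_two:
  assumes f: "f holomorphic_on UNIV" and U: "open U" "connected U" "U \<inter> Julia_set f \<noteq> {}"
    and ab: "a \<noteq> b"
  obtains n z where "z \<in> U" "(f ^^ n) z \<in> {a, b}"
proof (rule ccontr)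
  assume "\<not> thesis"
  with that have omit: "(f ^^ n) z \<noteq> a \<and> (f ^^ n) z \<noteq> b" if "z \<in> U" for n z
    using that by blast
  have "normal_family_on U {f ^^ n | n. n \<ge> 1}"
    using omit funpow_holomorphic_on[OF f]
    by (intro normal_family_on_omits[OF U(1,2) ab]) auto
  then have "U \<subseteq> Fatou_set f"
    using U(1,2) by (auto simp: Fatou_set_def)
  with U(3) show False
    by (auto simp: Julia_set_def)
qed

lemma escaping_set_step: "f z \<in> escaping_set f \<longleftrightarrow> z \<in> escaping_set f"
  using filterlim_sequentially_Suc[of "\<lambda>n. (f ^^ n) z" at_infinity]
  by (simp add: escaping_set_def funpow_swap1)

lemma escaping_set_funpow: "(f ^^ n) z \<in> escaping_set f \<longleftrightarrow> z \<in> escaping_set f"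
  by (induction n) (auto simp: escaping_set_step)

lemma escaping_set_eventually_gt:
  assumes "z \<in> escaping_set f"
  shows "\<forall>\<^sub>F n in sequentially. B < norm ((f ^^ n) z)"
  using filterlim_at_infinity_imp_norm_at_top[of "\<lambda>n. (f ^^ n) z" sequentially] assms
  unfolding escaping_set_def filterlim_at_top_dense by blast

text \<open>\<open>Julia_hits_one_of_two\<close> promises only one of two values, so finding a
  bounded orbit in \<open>U\<close> takes two of them. As \<open>f\<close> is no translation, some
  \<open>p\<close> has \<open>f (f p) = p\<close>. Either \<open>p\<close> and \<open>f p\<close>
  form a 2-cycle, or \<open>p\<close> is fixed and there is another fixed point or another preimage
  of \<open>p\<close>, since otherwise \<open>f\<close> would be affine.\<close>

lemma two_bounded_orbits:
  assumes "transcendental_entire f"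
  obtains v w where "v \<noteq> w" "bounded (range (\<lambda>n. (f ^^ n) v))" "bounded (range (\<lambda>n. (f ^^ n) w))"
proof -
  have f: "f holomorphic_on UNIV" and npoly: "f \<noteq> poly p" for p
    using assms by (auto simp: transcendental_entire_def)
  have "f \<noteq> (\<lambda>x. a + x)" for a
    using npoly[of "[:a, 1:]"] by auto
  then obtain p where p: "f (f p) = p"
    using holomorphic_involution_point[OF f] by blast
  have inv: "bounded (range (\<lambda>n. (f ^^ n) z))" if "finite S" "z \<in> S" "f ` S \<subseteq> S" for S z
  proof -
    have "(f ^^ n) z \<in> S" for n
      using that by (induction n) auto
    then show ?thesis
      by (meson bounded_subset finite_imp_bounded image_subsetI \<open>finite S\<close>)
  qed
  show thesis
  proof (cases "f p = p")
    case False
    have "f ` {p, f p} \<subseteq> {p, f p}"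
      by (simp add: p)
    note inv' = inv[OF _ _ this]
    show thesis
      by (rule that[OF False inv' inv']) simp_all
  next
    case True
    show thesis
    proof (cases "\<exists>z. z \<noteq> p \<and> (f z = p \<or> f z = z)")
      case True
      then obtain z where z: "z \<noteq> p" "f z = p \<or> f z = z" by blast
      from z(2) have "f ` {z, p} \<subseteq> {z, p}"
        by (elim disjE) (simp_all add: \<open>f p = p\<close>)
      note inv' = inv[OF _ _ this]
      show thesis
        by (rule that[OF z(1) inv' inv']) simp_all
    next
      case False
      \<comment> \<open>The exponential uniformises the punctured plane, so little Picard applies to
        \<open>(f z - p) / (z - p)\<close>, which omits \<open>0\<close> and \<open>1\<close> there.\<close>
      define G where "G = (\<lambda>u. (f (p + exp u) - p) / exp u)"
      have "(\<lambda>u. f (p + exp u)) holomorphic_on UNIV"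
      proof -
        have "(\<lambda>u. p + exp u) holomorphic_on UNIV"
          by (intro holomorphic_intros)
        then show ?thesis
          using holomorphic_on_compose_gen[OF _ f subset_UNIV] by (simp add: o_def)
      qed
      then have "G holomorphic_on UNIV"
        unfolding G_def by (intro holomorphic_intros) auto
      moreover have "G u \<noteq> 0 \<and> G u \<noteq> 1" for u
        using False[simplified, rule_format, of "p + exp u"] by (auto simp: G_def diff_eq_eq add.commute)
      ultimately obtain c where c: "G = (\<lambda>u. c)"
        using little_Picard_01 by blast
      \<comment> \<open>Off \<open>p\<close> this is the constancy of \<open>G\<close>, read at the
        logarithm of \<open>z - p\<close>; at \<open>p\<close> it is \<open>f p = p\<close>.\<close>
      have "f z = poly [:p - c * p, c:] z" for z
      proof (cases "z = p")
        case False
        then have "(f z - p) / (z - p) = c"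
          using fun_cong[OF c, of "Ln (z - p)"] by (simp add: G_def)
        with False show ?thesis by (simp add: field_simps)
      qed (use \<open>f p = p\<close> in \<open>simp add: algebra_simps\<close>)
      with npoly show thesis by blast
    qed
  qed
qed

section \<open>Filled images\<close>

text \<open>This gives access to the theory of \<open>outside\<close>, whose connectedness and
  cobounded complement are used for the filled images.\<close>

lemma fill_holes_eq_Compl_outside: "fill_holes G = - outside G"
proof -
  have "\<Union>{C \<in> components (- G). bounded C} = inside G"
  proof (intro equalityI subsetI)
    fix x assume "x \<in> \<Union>{C \<in> components (- G). bounded C}"
    then obtain C where "C \<in> components (- G)" "bounded C" "x \<in> C" by blast
    then show "x \<in> inside G"
      unfolding inside_def components_iff
      by (auto dest: connected_component_in simp: connected_component_eq)
  next
    fix x assume "x \<in> inside G"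
    then show "x \<in> \<Union>{C \<in> components (- G). bounded C}"
      unfolding inside_def
      by (auto intro!: exI[of _ "connected_component_set (- G) x"] componentsI)
  qed
  then show ?thesis
    by (simp add: fill_holes_def union_with_inside)
qed

text \<open>A frontier point of \<open>outside G\<close> is not in \<open>G\<close>, which is open
  and disjoint from \<open>outside G\<close>. Nor is it off the closure of \<open>G\<close>: a ball
  around it missing \<open>G\<close> meets \<open>outside G\<close>, so lies in a single outer
  component, making the point interior.\<close>

lemma frontier_fill_holes_subset:
  assumes "open G"
  shows "frontier (fill_holes G) \<subseteq> frontier G"
proof
  fix x assume "x \<in> frontier (fill_holes G)"
  then have x: "x \<in> frontier (outside G)"
    by (simp add: fill_holes_eq_Compl_outside frontier_complement)
  have "G \<inter> closure (outside G) = {}"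
    using open_Int_closure_eq_empty[OF assms, of "outside G"] outside_no_overlap[of G] by blast
  with x have "x \<notin> G"
    by (auto simp: frontier_def)
  moreover have "x \<in> closure G"
  proof (rule ccontr)
    assume "x \<notin> closure G"
    then obtain e where e: "e > 0" "ball x e \<subseteq> - closure G"
      using open_contains_ball[of "- closure G"] by auto
    have "ball x e \<inter> outside G \<noteq> {}"
      using x e(1) by (force simp: frontier_def closure_approachable dist_commute)
    then obtain y where y: "y \<in> ball x e" "y \<in> outside G" by blast
    have "ball x e \<subseteq> outside G"
    proof
      fix u assume "u \<in> ball x e"
      then have "connected_component (- G) y u"
        using y(1) e(2) closure_subset[of G] connected_componentI[of "ball x e" "- G" y u] by auto
      with y(2) show "u \<in> outside G"
        using outside_same_component by blast
    qed
    with e(1) have "x \<in> interior (outside G)"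
      by (meson centre_in_ball interiorI open_ball)
    with x show False
      by (auto simp: frontier_def)
  qed
  ultimately show "x \<in> frontier G"
    using assms by (simp add: frontier_def interior_open)
qed

text \<open>The complementary component of \<open>x\<close> is connected and unbounded, so it
  crosses the circle. This supplies omitted values of prescribed modulus.\<close>

lemma outside_meets_sphere:
  fixes G :: "complex set"
  assumes "x \<in> outside G" "norm x < r"
  obtains a where "a \<notin> G" "norm a = r"
proof -
  define T where "T = connected_component_set (- G) x"
  have "x \<in> T"
    using assms(1) by (auto simp: T_def outside_def)
  moreover obtain y where "y \<in> T" "r < norm y"
    using assms(1) by (auto simp: T_def outside_connected_component_lt)
  moreover have "connected T"
    by (simp add: T_def)
  ultimately have "T \<inter> frontier (ball 0 r) \<noteq> {}"
    using assms(2) by (intro connected_Int_frontier) auto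
  then obtain a where "a \<in> T" "norm a = r"
    using assms(2) norm_ge_zero[of x] by (force simp: frontier_ball)
  then show thesis
    using that connected_component_subset[of "- G" x] by (auto simp: T_def)
qed

text \<open>The image of the compact closure of \<open>S\<close> is closed, so it contains the
  closure of \<open>g\<close> S\<open>; as\<close>g \<open>S\<close> is open, its frontier points
  can only come from the frontier of \<open>S\<close>.\<close>

lemma frontier_image_subset:
  fixes g :: "'a::euclidean_space \<Rightarrow> 'b::euclidean_space"
  assumes "bounded S" "continuous_on UNIV g" "open (g ` S)"
  shows "frontier (g ` S) \<subseteq> g ` frontier S"
proof -
  have "compact (g ` closure S)"
    using assms by (intro compact_continuous_image) (auto intro: continuous_on_subset)
  then have "closure (g ` S) \<subseteq> g ` closure S"
    by (meson closure_minimal closure_subset compact_imp_closed image_mono)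
  moreover have "closure S \<subseteq> S \<union> frontier S"
    using closure_Un_frontier by blast
  ultimately show ?thesis
    using assms(3) by (simp add: frontier_def[of "g ` S"] interior_open) blast
qed

lemma transcendental_entire_open_funpow:
  assumes "transcendental_entire f" "open S"
  shows "open ((f ^^ n) ` S)"
proof (induction n)
  case (Suc n)
  have f: "f holomorphic_on UNIV"
    using assms by (simp add: transcendental_entire_def)
  have "\<not> f constant_on UNIV"
  proof
    assume "f constant_on UNIV"
    then obtain c where "f z = c" for z
      by (auto simp: constant_on_def)
    then have "f = poly [:c:]"
      by auto
    with assms show False by (auto simp: transcendental_entire_def)
  qed
  then have "open (f ` ((f ^^ n) ` S))"
    using open_mapping_thm[OF f open_UNIV connected_UNIV] Suc by simp
  then show ?case by (simp add: image_comp)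
qed (use assms in simp)

lemma eventually_fill_holes_covers:
  assumes f: "f holomorphic_on UNIV" and U: "open U" "connected U"
    and p: "p \<in> U" "bounded (range (\<lambda>n. (f ^^ n) p))"
    and q: "q \<in> U" "q \<in> escaping_set f"
  shows "\<forall>\<^sub>F n in sequentially. cball 0 R \<subseteq> fill_holes ((f ^^ n) ` U)"
proof (rule ccontr)
  assume "\<not> ?thesis"
  then have inf: "infinite {n. \<not> cball 0 R \<subseteq> fill_holes ((f ^^ n) ` U)}"
    by (simp add: cofinite_eq_sequentially[symmetric] eventually_cofinite)
  \<comment> \<open>Both radii exceed the modulus of an uncovered point, and their difference 1
    keeps the two omitted values at distance at least 1.\<close>
  have ex: "R \<ge> 0 \<and> (\<exists>a b. a \<notin> (f ^^ n) ` U \<and> b \<notin> (f ^^ n) ` U \<and> norm a = R + 1 \<and> norm b = R + 2)"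
    if n: "\<not> cball 0 R \<subseteq> fill_holes ((f ^^ n) ` U)" for n
  proof -
    obtain x where x: "norm x \<le> R" "x \<in> outside ((f ^^ n) ` U)"
      using n by (auto simp: fill_holes_eq_Compl_outside)
    then obtain a b where "a \<notin> (f ^^ n) ` U" "norm a = R + 1" "b \<notin> (f ^^ n) ` U" "norm b = R + 2"
      using outside_meets_sphere[OF x(2), of "R + 1"] outside_meets_sphere[OF x(2), of "R + 2"]
      by (metis add_strict_increasing2 less_add_same_cancel1 order.strict_trans1 zero_less_numeral
          zero_less_one)
    moreover have "R \<ge> 0"
      using x(1) norm_ge_zero order_trans by blast
    ultimately show ?thesis by blast
  qed
  define e where "e = enumerate {n. \<not> cball 0 R \<subseteq> fill_holes ((f ^^ n) ` U)}"
  have e: "strict_mono e" "\<not> cball 0 R \<subseteq> fill_holes ((f ^^ e k) ` U)" for k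
    using strict_mono_enumerate[OF inf] enumerate_in_set[OF inf] by (auto simp: e_def)
  have R: "R \<ge> 0"
    using ex[OF e(2)] by blast
  obtain a b where ab: "a k \<notin> (f ^^ e k) ` U" "b k \<notin> (f ^^ e k) ` U"
      "norm (a k) = R + 1" "norm (b k) = R + 2" for k
    using ex[OF e(2)] by metis
  have ab_ge: "1 \<le> norm (b k - a k)" for k
    using norm_triangle_ineq2[of "b k" "a k"] ab(3,4)[of k] by simp
  have ab_le: "norm (b k - a k) \<le> 2 * R + 3" for k
    using norm_triangle_ineq4[of "b k" "a k"] ab(3,4)[of k] by simp
  have ab_ne: "b k - a k \<noteq> 0" for k
    using ab_ge[of k] by auto
  \<comment> \<open>The omitted values vary with \<open>k\<close>, so they are moved to 0 and 1. The
    scaling factors lie between 1 and \<open>2 * R + 3\<close>, so bounds transfer between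
    \<open>t\<close> and the iterates uniformly in \<open>k\<close>.\<close>
  define t where "t = (\<lambda>k z. ((f ^^ e k) z - a k) / (b k - a k))"
  have "normal_family_on U (range t)"
  proof (rule normal_family_on_omits_01[OF U])
    show "h holomorphic_on U" if "h \<in> range t" for h
      using that ab_ne funpow_holomorphic_on[OF f] unfolding t_def
      by (auto intro!: holomorphic_intros)
    show "h z \<noteq> 0 \<and> h z \<noteq> 1" if h: "h \<in> range t" and z: "z \<in> U" for h z
    proof -
      obtain k where k: "h = t k" using h by blast
      have "(f ^^ e k) z \<noteq> a k" "(f ^^ e k) z \<noteq> b k"
        using ab(1,2)[of k] z by (metis image_eqI)+
      with ab_ne[of k] show ?thesis
        by (auto simp: k t_def)
    qed
  qed
  then obtain r where r: "strict_mono (r :: nat \<Rightarrow> nat)" and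
    alt: "(\<exists>g. \<forall>K. compact K \<and> K \<subseteq> U \<longrightarrow> uniform_limit K (\<lambda>k. t (r k)) g sequentially) \<or>
      (\<forall>K. compact K \<and> K \<subseteq> U \<longrightarrow>
        (\<forall>B::real. \<forall>\<^sub>F k in sequentially. \<forall>z\<in>K. B \<le> norm (t (r k) z)))"
    unfolding normal_family_on_def by blast
  show False
    using alt
  proof
    \<comment> \<open>A finite limit would bound the iterates at the escaping point \<open>q\<close>
      along a subsequence.\<close>
    assume "\<exists>g. \<forall>K. compact K \<and> K \<subseteq> U \<longrightarrow> uniform_limit K (\<lambda>k. t (r k)) g sequentially"
    then obtain g where "uniform_limit {q} (\<lambda>k. t (r k)) g sequentially"
      using q(1) by (meson compact_sing empty_subsetI insert_subset)
    then have "(\<lambda>k. t (r k) q) \<longlonglongrightarrow> g q"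
      by (rule tendsto_uniform_limitI) simp
    then have "bounded (range (\<lambda>k. t (r k) q))"
      by (rule convergent_imp_bounded)
    then obtain B where B: "\<And>k. norm (t (r k) q) \<le> B"
      by (auto simp: bounded_iff)
    have bound: "norm ((f ^^ e (r k)) q) \<le> B * (2 * R + 3) + (R + 1)" for k
    proof -
      have "(f ^^ e (r k)) q = t (r k) q * (b (r k) - a (r k)) + a (r k)"
        using ab_ne[of "r k"] by (simp add: t_def)
      then have "norm ((f ^^ e (r k)) q) \<le> norm (t (r k) q) * norm (b (r k) - a (r k)) + norm (a (r k))"
        by (metis norm_mult norm_triangle_ineq)
      also have "\<dots> \<le> B * (2 * R + 3) + (R + 1)"
        using B[of k] ab_le[of "r k"] ab(3)[of "r k"] order_trans[OF norm_ge_zero B[of k]]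
        by (intro add_mono mult_mono) auto
      finally show ?thesis .
    qed
    have "\<forall>\<^sub>F n in sequentially. B * (2 * R + 3) + (R + 1) < norm ((f ^^ n) q)"
      using q(2) by (rule escaping_set_eventually_gt)
    moreover have "filterlim (\<lambda>k. e (r k)) sequentially sequentially"
      using filterlim_subseq[OF strict_mono_o[OF e(1) r]] by (simp add: o_def)
    ultimately have "\<forall>\<^sub>F k in sequentially. B * (2 * R + 3) + (R + 1) < norm ((f ^^ e (r k)) q)"
      by (rule eventually_compose_filterlim)
    then obtain k where "B * (2 * R + 3) + (R + 1) < norm ((f ^^ e (r k)) q)"
      using eventually_happens' sequentially_bot by blast
    with bound[of k] show False by simp
  next
    \<comment> \<open>Divergence to infinity fails at \<open>p\<close>, whose orbit is
      bounded.\<close>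
    assume "\<forall>K. compact K \<and> K \<subseteq> U \<longrightarrow>
        (\<forall>B::real. \<forall>\<^sub>F k in sequentially. \<forall>z\<in>K. B \<le> norm (t (r k) z))"
    then have large: "\<forall>\<^sub>F k in sequentially. \<forall>z\<in>{p}. B \<le> norm (t (r k) z)" for B
      using p(1) by (meson compact_sing empty_subsetI insert_subset)
    obtain B where B: "\<And>n. norm ((f ^^ n) p) \<le> B"
      using p(2) by (auto simp: bounded_iff)
    have "norm (t k p) \<le> B + (R + 1)" for k
    proof -
      have "norm (t k p) = norm ((f ^^ e k) p - a k) / norm (b k - a k)"
        by (simp add: t_def norm_divide)
      also have "\<dots> \<le> norm ((f ^^ e k) p - a k)"
        using ab_ge[of k] by (simp add: divide_le_eq mult_le_cancel_left1)
      also have "\<dots> \<le> B + (R + 1)"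
        using norm_triangle_ineq4[of "(f ^^ e k) p" "a k"] B[of "e k"] ab(3)[of k] by simp
      finally show ?thesis .
    qed
    moreover obtain k where "B + (R + 1) + 1 \<le> norm (t (r k) p)"
      using large[of "B + (R + 1) + 1"] eventually_happens' sequentially_bot by fastforce
    ultimately show False
      by (metis add_le_same_cancel1 not_one_le_zero order_trans)
  qed
qed

section \<open>Connectedness of the escaping set\<close>

lemma connected_escaping_set:
  assumes f: "f holomorphic_on UNIV" and op: "\<And>n S. open S \<Longrightarrow> open ((f ^^ n) ` S)"
    and W: "\<And>n. bounded (W n)" "\<And>n. connected (- W n)"
    and fr: "\<And>n. n \<ge> 1 \<Longrightarrow> frontier (W n) \<subseteq> escaping_set f"
    and cover: "\<And>R. \<forall>\<^sub>F n in sequentially. cball 0 R \<subseteq> W n"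
  shows "connected (escaping_set f)"
proof (rule ccontr)
  let ?I = "escaping_set f"
  have cover': "\<exists>n\<ge>1. cball 0 R \<subseteq> W n" for R
    using eventually_conj[OF cover[of R] eventually_ge_at_top[of 1]]
      eventually_happens' sequentially_bot by blast
  assume "\<not> connected ?I"
  then obtain C1 C2 where C: "C1 \<union> C2 = ?I" "C1 \<noteq> {}" "C2 \<noteq> {}" "separatedin euclidean C1 C2"
    using connectedin_eq_not_separated[of euclidean ?I] by auto
  \<comment> \<open>Separated sets in a metric space have disjoint open neighbourhoods, so the set
    to be cut along becomes closed.\<close>
  obtain O1 O2 where O: "open O1" "open O2" "C1 \<subseteq> O1" "C2 \<subseteq> O2" "O1 \<inter> O2 = {}"
    using metrizable_space_separation[OF metrizable_space_euclidean C(4)]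
    by (auto simp: disjnt_def)
  obtain a b where ab: "a \<in> C1" "b \<in> C2"
    using C by blast
  have "\<not> connected_component (- (- (O1 \<union> O2))) a b"
  proof
    assume "connected_component (- (- (O1 \<union> O2))) a b"
    then obtain T where "connected T" "T \<subseteq> O1 \<union> O2" "a \<in> T" "b \<in> T"
      by (auto simp: connected_component_def)
    moreover have "a \<in> O1" "b \<in> O2"
      using O ab by auto
    ultimately show False
      using connectedD[of T O1 O2] O(1,2,5) by blast
  qed
  \<comment> \<open>A closed set separating two points of the plane has a single component that
    already separates them.\<close>
  then obtain A where A: "A \<in> components (- (O1 \<union> O2))" and sep: "\<not> connected_component (- A) a b"
    using separation_by_component_closed_pointwise[of "- (O1 \<union> O2)" a b] O(1,2) by auto
  have AI: "A \<inter> ?I = {}"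
    using in_components_subset[OF A] C(1) O by blast
  have closed_A: "closed A"
    using closed_components[OF closed_Compl[OF open_Un[OF O(1,2)]] A] .
  have conn_A: "connected A" and ne_A: "A \<noteq> {}"
    using in_components_connected[OF A] in_components_nonempty[OF A] by simp_all
  have bdd_A: "bounded A"
  proof (rule ccontr)
    assume unb: "\<not> bounded A"
    obtain x where x: "x \<in> A" using ne_A by blast
    obtain n where n: "n \<ge> 1" "cball 0 (norm x) \<subseteq> W n"
      using cover' by blast
    then have "x \<in> W n" by auto
    then have "A \<inter> frontier (W n) \<noteq> {}"
      using x unb W(1) bounded_subset by (intro connected_Int_frontier conn_A) blast+
    with fr[OF n(1)] AI show False by blast
  qed
  \<comment> \<open>The complement of the bounded set \<open>A\<close> has only one unbounded
    component, and \<open>a\<close> and \<open>b\<close> lie in different components.\<close>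
  obtain z where z: "z \<in> ?I" "bounded (connected_component_set (- A) z)"
  proof -
    have "bounded (connected_component_set (- A) a) \<or> bounded (connected_component_set (- A) b)"
    proof (rule ccontr)
      assume "\<not> ?thesis"
      then have "connected_component_set (- A) a = connected_component_set (- A) b"
        using bdd_A by (intro cobounded_unique_unbounded_component) auto
      moreover have "b \<notin> A"
        using ab C(1) AI by blast
      ultimately have "connected_component (- A) a b"
        by (metis ComplI connected_component_refl mem_Collect_eq)
      with sep show False by contradiction
    qed
    then show thesis using that ab C(1) by blast
  qed
  define H where "H = connected_component_set (- A) z"
  have "z \<in> H"
    using z(1) AI by (auto simp: H_def)
  have open_H: "open H"
    using closed_A by (auto simp: H_def intro!: open_connected_component)
  have bdd_H: "bounded H"
    using z by (simp add: H_def)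
  have fr_H: "frontier H \<subseteq> A"
    using frontier_of_connected_component_subset[of "- A" z] frontier_subset_closed[OF closed_A]
    by (auto simp: H_def frontier_complement)
  have cont: "continuous_on S (f ^^ n)" for S n
    by (intro holomorphic_on_imp_continuous_on funpow_holomorphic_on f)
  have "A \<subseteq> ?I"
  proof
    fix x assume x: "x \<in> A"
    have "\<forall>\<^sub>F n in sequentially. R \<le> norm ((f ^^ n) x)" for R
    proof -
      \<comment> \<open>\<open>m\<close> and the bound \<open>S\<close> for \<open>W m\<close> do
        not depend on \<open>n\<close>; every \<open>n\<close> at which the orbit of
        \<open>z\<close> exceeds \<open>S\<close> will do.\<close>
      obtain m where m: "m \<ge> 1" "cball 0 R \<subseteq> W m"
        using cover' by blast
      obtain S where S: "\<And>y. y \<in> W m \<Longrightarrow> norm y \<le> S"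
        using W(1)[of m] by (auto simp: bounded_iff)
      have "\<forall>\<^sub>F n in sequentially. S < norm ((f ^^ n) z)"
        using z(1) by (rule escaping_set_eventually_gt)
      then show ?thesis
      proof eventually_elim
        case (elim n)
        then have zW: "(f ^^ n) z \<notin> W m"
          using S by force
        have "(f ^^ n) x \<notin> W m"
        proof
          assume xW: "(f ^^ n) x \<in> W m"
          have "connected ((f ^^ n) ` A)"
            by (intro connected_continuous_image cont conn_A)
          moreover have "(f ^^ n) ` A \<inter> frontier (W m) = {}"
            using AI fr[OF m(1)] escaping_set_funpow[of n f] by blast
          ultimately have AW: "(f ^^ n) ` A \<subseteq> W m"
            using connected_Int_frontier[of "(f ^^ n) ` A" "W m"] x xW by blast
          \<comment> \<open>The connected set \<open>- W m\<close> meets the image of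
            \<open>H\<close> at \<open>(f ^^ n) z\<close> but misses its frontier, so it lies inside
            that bounded image, which is absurd.\<close>
          have "frontier ((f ^^ n) ` H) \<subseteq> W m"
            using frontier_image_subset[OF bdd_H cont op[OF open_H]] fr_H AW by blast
          then have "- W m \<subseteq> (f ^^ n) ` H"
            using connected_Int_frontier[OF W(2)[of m], of "(f ^^ n) ` H"] zW \<open>z \<in> H\<close> by blast
          moreover have "bounded ((f ^^ n) ` H)"
          proof -
            have "compact ((f ^^ n) ` closure H)"
              using bdd_H by (intro compact_continuous_image cont) auto
            then show ?thesis
              by (meson bounded_subset closure_subset compact_imp_bounded image_mono)
          qed
          ultimately have "bounded (- W m)"
            using bounded_subset by blast
          with W(1)[of m] show False
            using cobounded_imp_unbounded by blast
        qed
        with m(2) show "R \<le> norm ((f ^^ n) x)"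
          by (meson linear mem_cball_0 subsetD)
      qed
    qed
    then show "x \<in> ?I"
      by (simp add: escaping_set_def filterlim_at_infinity[OF order_refl])
  qed
  with AI ne_A show False by blast
qed

section \<open>Choice of \<open>p\<close> and \<open>q\<close> in \<open>U\<close>, and assembly of
  (a) and (b)\<close>

theorem theorem2:
  fixes f :: "complex \<Rightarrow> complex" and U :: "complex set"
  assumes "transcendental_entire f"
    and "open U" and "connected U" and "U \<noteq> {}" and "bounded U"
    and "frontier U \<subseteq> escaping_set f"
    and "U \<inter> Julia_set f \<noteq> {}"
  shows "((\<forall>n\<ge>1. frontier (fill_holes ((f ^^ n) ` U)) \<subseteq> escaping_set f) \<and>
          compact_sets_to_infinity (\<lambda>n. frontier (fill_holes ((f ^^ n) ` U))) \<and>
          (\<forall>\<^sub>F n in sequentially. surrounds (frontier (fill_holes ((f ^^ n) ` U))) 0)) \<and>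
         connected (escaping_set f)"
proof -
  have f: "f holomorphic_on UNIV"
    using assms(1) by (simp add: transcendental_entire_def)
  have cont: "continuous_on S (f ^^ n)" for S n
    by (intro holomorphic_on_imp_continuous_on funpow_holomorphic_on f)
  define W where "W n = fill_holes ((f ^^ n) ` U)" for n
  have bdd_U: "bounded ((f ^^ n) ` U)" for n
  proof -
    have "compact ((f ^^ n) ` closure U)"
      using assms(5) by (intro compact_continuous_image cont) auto
    then show ?thesis
      by (meson bounded_subset closure_subset compact_imp_bounded image_mono)
  qed
  have bdd: "bounded (W n)" and conn: "connected (- W n)" for n
    using bdd_U[of n] by (simp_all add: W_def fill_holes_eq_Compl_outside cobounded_outside connected_outside)
  have ne: "W n \<noteq> {}" for n
    using assms(4) by (simp add: W_def fill_holes_def)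
  have fr: "frontier (W n) \<subseteq> escaping_set f" for n
  proof -
    \<comment> \<open>Filling holes and taking open images create no new frontier, so every frontier
      point of \<open>W n\<close> is an iterate of a frontier point of \<open>U\<close>, and
      iterates of escaping points escape.\<close>
    have "open ((f ^^ n) ` U)"
      using assms(1,2) by (rule transcendental_entire_open_funpow)
    then have "frontier (W n) \<subseteq> (f ^^ n) ` frontier U"
      using frontier_fill_holes_subset frontier_image_subset[OF assms(5) cont] unfolding W_def by blast
    then show ?thesis
      using assms(6) escaping_set_funpow[of n f] by blast
  qed
  obtain p where p: "p \<in> U" "bounded (range (\<lambda>n. (f ^^ n) p))"
  proof -
    obtain v w where vw: "v \<noteq> w" "bounded (range (\<lambda>n. (f ^^ n) v))" "bounded (range (\<lambda>n. (f ^^ n) w))"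
      using two_bounded_orbits[OF assms(1)] .
    obtain m p where mp: "p \<in> U" "(f ^^ m) p \<in> {v, w}"
      using Julia_hits_one_of_two[OF f assms(2,3,7) vw(1)] .
    then have "bounded (range (\<lambda>n. (f ^^ n) ((f ^^ m) p)))"
      using vw by auto
    then have "bounded ((\<lambda>n. (f ^^ n) p) ` {..m} \<union> range (\<lambda>n. (f ^^ n) ((f ^^ m) p)))"
      by (simp add: finite_imp_bounded)
    moreover have "range (\<lambda>n. (f ^^ n) p) \<subseteq> (\<lambda>n. (f ^^ n) p) ` {..m} \<union> range (\<lambda>n. (f ^^ n) ((f ^^ m) p))"
    proof (intro image_subsetI)
      fix n
      show "(f ^^ n) p \<in> (\<lambda>n. (f ^^ n) p) ` {..m} \<union> range (\<lambda>n. (f ^^ n) ((f ^^ m) p))"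
      proof (cases "n \<le> m")
        case False
        then have "(f ^^ n) p = (f ^^ (n - m)) ((f ^^ m) p)"
          using funpow_add[of "n - m" m f] by simp
        then show ?thesis by blast
      qed auto
    qed
    ultimately show thesis
      using that mp(1) bounded_subset by blast
  qed
  obtain q where q: "q \<in> U" "q \<in> escaping_set f"
  proof -
    have "frontier U \<noteq> {}"
      using assms(4,5) frontier_eq_empty not_bounded_UNIV by blast
    then obtain x where x: "x \<in> escaping_set f"
      using assms(6) by blast
    \<comment> \<open>Two distinct escaping targets are required; a later iterate of
      \<open>x\<close> with larger modulus is the second.\<close>
    have "\<forall>\<^sub>F n in sequentially. norm x < norm ((f ^^ n) x)"
      using x by (rule escaping_set_eventually_gt)
    then obtain k where "norm x < norm ((f ^^ k) x)"
      using eventually_happens' sequentially_bot by blast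
    then have "x \<noteq> (f ^^ k) x" by auto
    then obtain m q where "q \<in> U" "(f ^^ m) q \<in> {x, (f ^^ k) x}"
      using Julia_hits_one_of_two[OF f assms(2,3,7)] by metis
    then show thesis
      using that x escaping_set_funpow[of m f q] escaping_set_funpow[of k f x] by auto
  qed
  have cover: "\<forall>\<^sub>F n in sequentially. cball 0 R \<subseteq> W n" for R
    unfolding W_def using eventually_fill_holes_covers[OF f assms(2,3) p q] .
  have fr_cpt: "compact (frontier (W n))" for n
    by (simp add: bdd compact_frontier_bounded)
  have fr_ne: "frontier (W n) \<noteq> {}" for n
    using ne bdd frontier_eq_empty not_bounded_UNIV by metis
  have "filterlim (\<lambda>n. INF z\<in>frontier (W n). norm z) at_top sequentially"
    unfolding filterlim_at_top
  proof
    fix R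
    show "\<forall>\<^sub>F n in sequentially. R \<le> (INF z\<in>frontier (W n). norm z)"
      using cover[of R]
    proof eventually_elim
      case (elim n)
      show ?case
      proof (rule cINF_greatest[OF fr_ne])
        fix z assume z: "z \<in> frontier (W n)"
        have "ball 0 R \<subseteq> interior (W n)"
          using elim by (meson ball_subset_cball interior_maximal open_ball order_trans)
        with z show "R \<le> norm z"
          by (force simp: frontier_def)
      qed
    qed
  qed
  moreover have "\<forall>\<^sub>F n in sequentially. surrounds (frontier (W n)) 0"
    using cover[of 1]
  proof eventually_elim
    case (elim n)
    define C where "C = connected_component_set (- frontier (W n)) 0"
    have "ball 0 1 \<subseteq> interior (W n)"
      using elim by (meson ball_subset_cball interior_maximal open_ball order_trans)
    then have "0 \<in> interior (W n)" by force
    then have 0: "0 \<in> W n" "0 \<notin> frontier (W n)"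
      using interior_subset by (auto simp: frontier_def)
    then have "0 \<in> C" by (simp add: C_def)
    \<comment> \<open>A connected set through 0 that avoids the frontier of \<open>W n\<close>
      cannot leave the bounded set \<open>W n\<close>.\<close>
    have "C \<inter> frontier (W n) = {}"
      using connected_component_subset by (fastforce simp: C_def)
    moreover have "connected C"
      by (simp add: C_def)
    ultimately have "C \<subseteq> W n"
      using connected_Int_frontier[of C "W n"] 0(1) \<open>0 \<in> C\<close> by blast
    then have "bounded C"
      using bdd bounded_subset by blast
    moreover have "C \<in> components (- frontier (W n))"
      using 0(2) by (simp add: C_def componentsI)
    ultimately show ?case
      using fr_cpt[of n] \<open>0 \<in> C\<close> unfolding surrounds_def by blast
  qed
  moreover have "connected (escaping_set f)"
    using connected_escaping_set[OF f transcendental_entire_open_funpow[OF assms(1)] bdd conn fr cover] .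
  ultimately show ?thesis
    using fr fr_cpt fr_ne by (simp add: compact_sets_to_infinity_def W_def)
qed

end
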